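(* Let $\Pi_n$ be a cyclic $n$-gon (a polygon with $n$ sides inscribed in a circle) in the Euclidean plane with area $A_n$, pseudo-perimeter $\hat L_n$ and associated constants $\varphi_n$, $\varphi_n^0$ and $\tau_n=\varphi_n/\varphi_n^0$. Suppose that $\tau_n\le 1$. Then the following Bonnesen-type isoperimetric inequality holds: $$\hat L_n^2-4\left(n\tan\frac{\pi}{n}\right)A_n\ \ge\ \hat L_n^2\left(1-\frac{\varphi_n}{\varphi_n^0}\right).$$ Equality holds if and only if $\Pi_n$ is regular (i.e. $\varphi_n=\varphi_n^0$). Moreover, this inequality implies that $\hat L_n^2-4\left(n\tan\frac{\pi}{n}\right)A_n\ge 0$, with equality if and only if $\Pi_n$ is regular.
   Context: For a plane $n$-gon $\Pi_n$ with side lengths $a_1,\dots,a_n$, perimeter $L_n=a_1+\dots+a_n$ and area $A_n$, define $$P_n=\frac{L_n^2}{4}\sqrt{\prod_{i=1}^n\left(1-\frac{2a_i}{L_n}\right)},\qquad \varphi_n=\frac{A_n}{P_n},$$ and the pseudo-perimeter $$\hat L_n=L_n\,\frac{n}{n-2}\left[\prod_{i=1}^n\left(1-\frac{2a_i}{L_n}\right)\right]^{1/n}.$$ The value of $\varphi_n$ for the regular $n$-gon is $$\varphi_n^0=\frac{1}{n\tan\frac{\pi}{n}\,\left(1-\frac2n\right)^{n/2}}.$$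
   Formalization: Both inequalities are claimed only for n≠3 (the 3-4-5 triangle violates them); "equality only if regular" only for n≠4 (a 1×2 rectangle gives equality); "i.e. φ_n=φ_n^0" is read as: regular implies φ_n=φ_n^0, the converse being false for n=3,4. *)

theory Defs
  imports "HOL-Analysis.Analysis"
begin

text \<open>
  A plane \<open>n\<close>-gon is given by its list of vertices \<open>v 0, \<dots>, v (n - 1)\<close> in the Euclidean plane, here
  the type \<^typ>\<open>complex\<close>. Indices are read modulo \<open>n\<close>; values of \<open>v\<close> beyond \<open>n - 1\<close> are irrelevant.
\<close>

definition vertex :: "nat \<Rightarrow> (nat \<Rightarrow> complex) \<Rightarrow> nat \<Rightarrow> complex" where
  "vertex n v i = v (i mod n)"

definition side :: "nat \<Rightarrow> (nat \<Rightarrow> complex) \<Rightarrow> nat \<Rightarrow> complex set" where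
  "side n v i = closed_segment (vertex n v i) (vertex n v (i + 1))"

definition side_length :: "nat \<Rightarrow> (nat \<Rightarrow> complex) \<Rightarrow> nat \<Rightarrow> real" where
  "side_length n v i = dist (vertex n v i) (vertex n v (i + 1))"

definition boundary :: "nat \<Rightarrow> (nat \<Rightarrow> complex) \<Rightarrow> complex set" where
  "boundary n v = (\<Union>i<n. side n v i)"

text \<open>
  Distinct vertices, and two different sides have no point in common except a shared endpoint
  (so adjacent sides meet in exactly one point, non-adjacent sides not at all).
\<close>

definition polygon :: "nat \<Rightarrow> (nat \<Rightarrow> complex) \<Rightarrow> bool" where
  "polygon n v \<longleftrightarrow> n \<ge> 3 \<and> inj_on v {..<n} \<and>
     (\<forall>i<n. \<forall>j<n. i \<noteq> j \<longrightarrow>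
        side n v i \<inter> side n v j \<subseteq>
          {vertex n v i, vertex n v (i + 1)} \<inter> {vertex n v j, vertex n v (j + 1)})"

definition cyclic_polygon :: "nat \<Rightarrow> (nat \<Rightarrow> complex) \<Rightarrow> bool" where
  "cyclic_polygon n v \<longleftrightarrow> polygon n v \<and> (\<exists>c r. r > 0 \<and> (\<forall>i<n. v i \<in> sphere c r))"

definition angle_at :: "complex \<Rightarrow> complex \<Rightarrow> complex \<Rightarrow> real" where
  "angle_at p q r = arccos (((p - q) \<bullet> (r - q)) / (norm (p - q) * norm (r - q)))"

text \<open>
  The angle between two sides is unoriented, with values in \<open>[0, pi]\<close>. It is the interior angle
  because a regular polygon is also required to be convex.
\<close>

definition regular_polygon :: "nat \<Rightarrow> (nat \<Rightarrow> complex) \<Rightarrow> bool" where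
  "regular_polygon n v \<longleftrightarrow> polygon n v \<and> convex (inside (boundary n v)) \<and>
     (\<forall>i<n. \<forall>j<n. side_length n v i = side_length n v j) \<and>
     (\<forall>i<n. \<forall>j<n.
        angle_at (vertex n v i) (vertex n v (i + 1)) (vertex n v (i + 2)) =
        angle_at (vertex n v j) (vertex n v (j + 1)) (vertex n v (j + 2)))"

definition perimeter :: "nat \<Rightarrow> (nat \<Rightarrow> complex) \<Rightarrow> real" where
  "perimeter n v = (\<Sum>i<n. side_length n v i)"

definition area :: "nat \<Rightarrow> (nat \<Rightarrow> complex) \<Rightarrow> real" where
  "area n v = measure lebesgue (inside (boundary n v))"

definition pseudo_area :: "nat \<Rightarrow> (nat \<Rightarrow> complex) \<Rightarrow> real" where
  "pseudo_area n v = (perimeter n v)\<^sup>2 / 4 * sqrt (\<Prod>i<n. 1 - 2 * side_length n v i / perimeter n v)"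

definition phi :: "nat \<Rightarrow> (nat \<Rightarrow> complex) \<Rightarrow> real" where
  "phi n v = area n v / pseudo_area n v"

definition phi0 :: "nat \<Rightarrow> real" where
  "phi0 n = 1 / (real n * tan (pi / real n) * (1 - 2 / real n) powr (real n / 2))"

definition tau :: "nat \<Rightarrow> (nat \<Rightarrow> complex) \<Rightarrow> real" where
  "tau n v = phi n v / phi0 n"

definition pseudo_perimeter :: "nat \<Rightarrow> (nat \<Rightarrow> complex) \<Rightarrow> real" where
  "pseudo_perimeter n v = perimeter n v * (real n / (real n - 2)) *
     root n (\<Prod>i<n. 1 - 2 * side_length n v i / perimeter n v)"

end

theory Submission
  imports Defs
begin

text \<open>
  A side of a simple polygon inscribed in a circle has all other vertices strictly on one side of
  its line, for otherwise the chain of the remaining vertices would cross the side inside the disc.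
  Hence the boundary is the frontier of the convex hull of the vertices, the enclosed region is
  convex, and a polygon with equal sides consists of consecutive vertices of a regular one, which
  makes regularity equivalent to equality of the sides.

  Let \<open>G\<close> (below \<open>mean_ratio\<close>) be the geometric mean of the numbers \<open>1 - 2 a\<^sub>i / L\<close> divided by
  their arithmetic mean \<open>1 - 2 / n\<close>. Then \<open>G \<le> 1\<close> with equality exactly for equal sides, and the
  difference of the two sides of the inequality is
  \<open>4 n tan (\<pi> / n) A (G powr (2 - n / 2) - 1)\<close>. For \<open>n = 3\<close>, Heron's formula gives
  \<open>\<phi>\<^sub>3 = 1 = \<phi>\<^sub>3\<^sup>0\<close>.
\<close>

subsection \<open>Orientation and chords of a circle\<close>

definition orient :: "complex \<Rightarrow> complex \<Rightarrow> complex \<Rightarrow> real" where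
  "orient p q x = Im (cnj (q - p) * (x - p))"

lemma orient_swap: "orient p x q = - orient p q x"
  by (simp add: orient_def algebra_simps)

lemma orient_self [simp]: "orient p q p = 0" "orient p q q = 0" "orient p p q = 0"
  by (simp_all add: orient_def algebra_simps)

lemma orient_rev: "orient q p x = - orient p q x"
  by (simp add: orient_def algebra_simps)

lemma orient_inner: "orient p q x = (\<i> * (q - p)) \<bullet> x - (\<i> * (q - p)) \<bullet> p"
  by (simp add: orient_def inner_complex_def algebra_simps)

lemma orient_affine: "orient p q ((1 - s) *\<^sub>R u + s *\<^sub>R w) = (1 - s) * orient p q u + s * orient p q w"
  by (simp add: orient_inner inner_add_right algebra_simps)

lemma orient_zero_chord:
  assumes "cmod (p - c) = r" "cmod (q - c) = r" "p \<noteq> q" "orient p q x = 0"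
  obtains t where "x = p + t *\<^sub>R (q - p)"
    "(cmod (x - c))\<^sup>2 = r\<^sup>2 + (cmod (q - p))\<^sup>2 * (t\<^sup>2 - t)"
proof
  define d t where "d = q - p" and "t = Re (cnj d * (x - p)) / (cmod d)\<^sup>2"
  have d: "d \<noteq> 0" using assms by (simp add: d_def)
  have "cnj d * (x - p) = of_real (Re (cnj d * (x - p)))"
    using assms(4) unfolding orient_def d_def by (simp add: complex_eq_iff)
  then have "d * (cnj d * (x - p)) = d * of_real (t * (cmod d)\<^sup>2)"
    using d by (simp add: t_def)
  also have "d * (cnj d * (x - p)) = of_real ((cmod d)\<^sup>2) * (x - p)"
    by (simp add: complex_norm_square[symmetric] mult.assoc[symmetric] del: of_real_power)
  finally have "of_real ((cmod d)\<^sup>2) * (x - p) = of_real ((cmod d)\<^sup>2) * (of_real t * d)"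
    by (simp add: mult_ac)
  then have "x - p = of_real t * d"
    using d by simp
  then show x: "x = p + t *\<^sub>R (q - p)"
    by (simp add: d_def scaleR_conv_of_real algebra_simps)
  have "(cmod (q - c))\<^sup>2 = (cmod (p - c))\<^sup>2"
    using assms by simp
  then show "(cmod (x - c))\<^sup>2 = r\<^sup>2 + (cmod (q - p))\<^sup>2 * (t\<^sup>2 - t)"
    unfolding x assms(1)[symmetric] cmod_power2
    by (simp add: power2_eq_square) algebra
qed

lemma orient_zero_circle:
  assumes "cmod (p - c) = r" "cmod (q - c) = r" "cmod (x - c) = r" "p \<noteq> q" "orient p q x = 0"
  shows "x = p \<or> x = q"
proof -
  obtain t where t: "x = p + t *\<^sub>R (q - p)" "(cmod (x - c))\<^sup>2 = r\<^sup>2 + (cmod (q - p))\<^sup>2 * (t\<^sup>2 - t)"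
    using orient_zero_chord assms by metis
  then have "t * (t - 1) = 0"
    using assms by (simp add: power2_eq_square algebra_simps)
  then show ?thesis using t by auto
qed

lemma chords_cross:
  assumes "cmod (p - c) = r" "cmod (q - c) = r" "cmod (u - c) = r" "cmod (w - c) = r" "p \<noteq> q"
    and opp: "orient p q u * orient p q w < 0"
  shows "closed_segment p q \<inter> closed_segment u w \<noteq> {}"
proof -
  define s where "s = orient p q u / (orient p q u - orient p q w)"
  define x where "x = (1 - s) *\<^sub>R u + s *\<^sub>R w"
  have s: "0 \<le> s" "s \<le> 1" and ne: "orient p q u - orient p q w \<noteq> 0"
    using opp unfolding s_def by (auto simp: field_simps mult_less_0_iff)
  have xs: "x \<in> closed_segment u w"
    using s by (auto simp: x_def in_segment)
  have "orient p q x = 0"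
    unfolding x_def orient_affine using ne by (simp add: s_def field_simps)
  then obtain t where t: "x = p + t *\<^sub>R (q - p)"
    "(cmod (x - c))\<^sup>2 = r\<^sup>2 + (cmod (q - p))\<^sup>2 * (t\<^sup>2 - t)"
    using orient_zero_chord assms by metis
  have "closed_segment u w \<subseteq> cball c r"
    using assms by (intro closed_segment_subset) (auto simp: dist_norm norm_minus_commute)
  then have "cmod (x - c) \<le> r" using xs by (auto simp: dist_norm norm_minus_commute)
  then have "(cmod (x - c))\<^sup>2 \<le> r\<^sup>2" by (intro power_mono) auto
  then have "(cmod (q - p))\<^sup>2 * (t\<^sup>2 - t) \<le> 0" using t(2) by linarith
  moreover have "(cmod (q - p))\<^sup>2 > 0" using \<open>p \<noteq> q\<close> by simp
  ultimately have "t\<^sup>2 - t \<le> 0" by (simp add: mult_le_0_iff)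
  then have "t * (t - 1) \<le> 0" by (simp add: power2_eq_square algebra_simps)
  then have "0 \<le> t" "t \<le> 1" by (auto simp: mult_le_0_iff)
  then have "x \<in> closed_segment p q"
    unfolding in_segment by (intro exI[of _ t]) (simp add: t algebra_simps)
  with xs show ?thesis by blast
qed

definition extreme_chord :: "complex set \<Rightarrow> complex \<Rightarrow> complex \<Rightarrow> bool" where
  "extreme_chord S p q \<longleftrightarrow> (\<forall>x\<in>S - {p, q}. orient p q x > 0) \<or> (\<forall>x\<in>S - {p, q}. orient p q x < 0)"

lemma extreme_chord_commute: "extreme_chord S p q \<longleftrightarrow> extreme_chord S q p"
  unfolding extreme_chord_def by (auto simp: orient_rev[of q p] insert_commute)

lemma extreme_chord_at_most_two:
  assumes "x \<in> S" "y \<in> S" "z \<in> S" "p \<notin> {x, y, z}" "x \<noteq> y"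
    and "extreme_chord S p x" "extreme_chord S p y" "extreme_chord S p z"
  shows "z = x \<or> z = y"
proof (rule ccontr)
  assume "\<not> ?thesis"
  then have "orient p x y * orient p x z > 0" "orient p y x * orient p y z > 0"
      "orient p z x * orient p z y > 0"
    using assms unfolding extreme_chord_def by (force intro: mult_pos_pos mult_neg_neg)+
  then have "0 < (orient p x y * orient p x z) * (orient p x z * orient p y z)"
      and "orient p x y * orient p y z < 0"
    by (simp_all add: orient_swap[of p y x] orient_swap[of p z])
  then have "0 < (orient p x z)\<^sup>2 * (orient p x y * orient p y z)"
    by (simp only: power2_eq_square mult_ac)
  with \<open>orient p x y * orient p y z < 0\<close> show False
    by (metis mult_nonneg_nonpos not_less order_less_imp_le zero_le_power2)
qed

subsection \<open>Simple polygons inscribed in a circle\<close>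

locale inscribed_polygon =
  fixes n :: nat and v :: "nat \<Rightarrow> complex" and c :: complex and r :: real
  assumes polygon: "polygon n v"
    and radius_pos: "r > 0"
    and on_circle: "\<And>i. i < n \<Longrightarrow> cmod (v i - c) = r"
begin

abbreviation V :: "nat \<Rightarrow> complex" where "V \<equiv> vertex n v"

lemma n_ge_3: "n \<ge> 3"
  using polygon by (simp add: polygon_def)

lemma V_eq_iff: "V i = V j \<longleftrightarrow> i mod n = j mod n"
proof -
  have "inj_on v {..<n}" "i mod n \<in> {..<n}" "j mod n \<in> {..<n}"
    using polygon n_ge_3 by (auto simp: polygon_def)
  then show ?thesis unfolding vertex_def by (rule inj_on_eq_iff)
qed

lemma V_on_circle: "cmod (V i - c) = r"
  using on_circle n_ge_3 by (simp add: vertex_def)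

lemma V_mod: "V (i mod n) = V i" "V (Suc (i mod n)) = V (Suc i)"
  by (simp_all add: vertex_def mod_Suc_eq)

lemma range_V: "range V = v ` {..<n}"
proof
  show "range V \<subseteq> v ` {..<n}"
    using n_ge_3 by (auto simp: vertex_def)
  show "v ` {..<n} \<subseteq> range V"
    by (clarsimp simp: vertex_def image_iff) (metis mod_less)
qed

lemma finite_range_V: "finite (range V)"
  unfolding range_V by (rule finite_imageI) (rule finite_lessThan)

lemma mod_add_eq_iff:
  assumes "j < n" "k < n"
  shows "(i + j) mod n = (i + k) mod n \<longleftrightarrow> j = k"
proof
  assume eq: "(i + j) mod n = (i + k) mod n"
  show "j = k"
  proof (rule ccontr)
    assume "j \<noteq> k"
    then consider "j < k" | "k < j" by linarith
    then show False
    proof cases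
      case 1
      then have "n dvd (i + k) - (i + j)" using eq by (subst mod_eq_dvd_iff_nat[symmetric]) auto
      then have "n \<le> k - j" using 1 by (intro dvd_imp_le) auto
      then show False using assms by linarith
    next
      case 2
      then have "n dvd (i + j) - (i + k)" using eq by (subst mod_eq_dvd_iff_nat[symmetric]) auto
      then have "n \<le> j - k" using 2 by (intro dvd_imp_le) auto
      then show False using assms by linarith
    qed
  qed
qed simp

lemma V_add_eq_iff: "j < n \<Longrightarrow> k < n \<Longrightarrow> V (i + j) = V (i + k) \<longleftrightarrow> j = k"
  by (simp add: V_eq_iff mod_add_eq_iff)

lemma V_Suc_neq: "V (Suc i) \<noteq> V i" "V i \<noteq> V (Suc i)" "V (Suc (Suc i)) \<noteq> V i"
  using V_add_eq_iff[of 1 0 i] V_add_eq_iff[of 2 0 i] n_ge_3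
  by (auto simp: numeral_2_eq_2)

lemma range_V_cases:
  assumes "x \<in> range V"
  obtains j where "j < n" "x = V (i + j)"
proof -
  obtain k where k: "x = V k" using assms by blast
  have "(\<lambda>j. (i + j) mod n) ` {..<n} = {..<n}"
    using n_ge_3 by (intro endo_inj_surj) (auto simp: inj_on_def mod_add_eq_iff)
  moreover have "k mod n \<in> {..<n}" using n_ge_3 by simp
  ultimately obtain j where "j < n" "(i + j) mod n = k mod n" by (metis (no_types, lifting) image_iff lessThan_iff)
  then show thesis using k V_eq_iff that by metis
qed

lemma side_eq: "side n v i = closed_segment (V i) (V (Suc i))"
  by (simp add: side_def)

lemma sides_meet:
  assumes "i mod n \<noteq> j mod n"
  shows "closed_segment (V i) (V (Suc i)) \<inter> closed_segment (V j) (V (Suc j)) \<subseteq>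
    {V i, V (Suc i)} \<inter> {V j, V (Suc j)}"
proof -
  have "i mod n < n" "j mod n < n" using n_ge_3 by auto
  then have "side n v (i mod n) \<inter> side n v (j mod n) \<subseteq>
    {V (i mod n), V (i mod n + 1)} \<inter> {V (j mod n), V (j mod n + 1)}"
    using polygon assms unfolding polygon_def by blast
  then show ?thesis unfolding side_eq V_mod Suc_eq_plus1[symmetric] .
qed

lemma extreme_side: "extreme_chord (range V) (V i) (V (Suc i))"
proof -
  let ?f = "orient (V i) (V (Suc i))"
  have nz: "?f (V (i + j)) \<noteq> 0" if "2 \<le> j" "j < n" for j
    using orient_zero_circle[of "V i" c r "V (Suc i)" "V (i + j)"] V_on_circle
      V_add_eq_iff[of j 0 i] V_add_eq_iff[of j 1 i] V_Suc_neq that by auto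
  have same: "?f (V (i + 2)) * ?f (V (i + j)) > 0" if "2 \<le> j" "j < n" for j
    using that
  proof (induction j rule: dec_induct)
    case base
    then show ?case using nz[of 2] by (auto simp: zero_less_mult_iff)
  next
    case (step j)
    have "\<not> ?f (V (i + j)) * ?f (V (i + Suc j)) < 0"
    proof
      assume "?f (V (i + j)) * ?f (V (i + Suc j)) < 0"
      then have "closed_segment (V i) (V (Suc i)) \<inter> closed_segment (V (i + j)) (V (i + Suc j)) \<noteq> {}"
        by (intro chords_cross[where c = c and r = r]) (auto simp: V_on_circle V_Suc_neq)
      moreover have "i mod n \<noteq> (i + j) mod n"
        using mod_add_eq_iff[of 0 j i] step by auto
      ultimately have "{V i, V (Suc i)} \<inter> {V (i + j), V (i + Suc j)} \<noteq> {}"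
        using sides_meet[of i "i + j"] by auto
      then show False
        using step V_add_eq_iff[of 0 j i] V_add_eq_iff[of 1 j i]
          V_add_eq_iff[of 0 "Suc j" i] V_add_eq_iff[of 1 "Suc j" i] by auto
    qed
    moreover have "?f (V (i + Suc j)) \<noteq> 0" "?f (V (i + 2)) * ?f (V (i + j)) > 0"
      using nz[of "Suc j"] step by auto
    ultimately show ?case by (auto simp: zero_less_mult_iff mult_less_0_iff not_less)
  qed
  have pos: "?f (V (i + 2)) * ?f x > 0" if "x \<in> range V - {V i, V (Suc i)}" for x
  proof -
    have "x \<in> range V" "x \<noteq> V i" "x \<noteq> V (Suc i)" using that by auto
    moreover obtain j where j: "j < n" "x = V (i + j)"
      using range_V_cases[OF \<open>x \<in> range V\<close>] .
    ultimately have "j \<noteq> 0" "j \<noteq> 1" by (metis add_0_right, metis Suc_eq_plus1)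
    then show ?thesis using same[of j] j by simp
  qed
  show ?thesis
  proof (cases "?f (V (i + 2)) > 0")
    case True
    then have "?f x > 0" if "x \<in> range V - {V i, V (Suc i)}" for x
      using pos[OF that] by (simp add: zero_less_mult_iff)
    then show ?thesis unfolding extreme_chord_def by blast
  next
    case False
    then have "?f x < 0" if "x \<in> range V - {V i, V (Suc i)}" for x
      using pos[OF that] by (simp add: zero_less_mult_iff)
    then show ?thesis unfolding extreme_chord_def by blast
  qed
qed

end

subsection \<open>Area of triangles in the complex plane\<close>

definition vec2 :: "complex \<Rightarrow> real ^ 2" where
  "vec2 z = (\<chi> i. if i = 1 then Re z else Im z)"

lemma vec2_nth [simp]: "vec2 z $ 1 = Re z" "vec2 z $ 2 = Im z"
  by (simp_all add: vec2_def)

lemma linear_vec2: "linear vec2"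
  by (intro linearI) (auto simp: vec_eq_iff forall_2)

lemma inj_vec2: "inj vec2"
  by (auto intro!: injI simp: vec_eq_iff forall_2 complex_eq_iff)

lemma dist_vec2: "dist (vec2 x) (vec2 y) = dist x y"
  by (simp add: dist_vec_def L2_set_def UNIV_2 dist_complex_def cmod_def dist_real_def)

lemma lborel_vec2: "lborel = distr lborel borel vec2"
proof (rule lborel_eqI)
  fix l u :: "real ^ 2"
  assume le: "\<And>b. b \<in> Basis \<Longrightarrow> l \<bullet> b \<le> u \<bullet> b"
  have B: "(Basis :: (real ^ 2) set) = {axis 1 1, axis 2 1}"
    by (auto simp: Basis_vec_def UNIV_2)
  have le: "l $ 1 \<le> u $ 1" "l $ 2 \<le> u $ 2"
    using le[of "axis 1 1"] le[of "axis 2 1"] by (auto simp: B inner_axis)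
  have meas: "vec2 \<in> borel_measurable lborel"
    using borel_measurable_continuous_onI[OF linear_continuous_on] linear_vec2
    by (simp add: linear_conv_bounded_linear)
  have "vec2 -` box l u = box (Complex (l $ 1) (l $ 2)) (Complex (u $ 1) (u $ 2))"
    by (auto simp: box_def B inner_axis Basis_complex_def)
  then have "emeasure (distr lborel borel vec2) (box l u)
      = emeasure lborel (box (Complex (l $ 1) (l $ 2)) (Complex (u $ 1) (u $ 2)))"
    using meas by (subst emeasure_distr) auto
  also have "\<dots> = ennreal ((u $ 1 - l $ 1) * (u $ 2 - l $ 2))"
    using le by (subst emeasure_lborel_box) (auto simp: Basis_complex_def)
  also have "(u $ 1 - l $ 1) * (u $ 2 - l $ 2) = (\<Prod>b\<in>Basis. (u - l) \<bullet> b)"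
    by (simp add: B inner_axis axis_eq_axis)
  finally show "emeasure (distr lborel borel vec2) (box l u) = ennreal (\<Prod>b\<in>Basis. (u - l) \<bullet> b)" .
qed simp

lemma measure_triangle_vec2:
  "measure lebesgue (convex hull {x, y, z}) = measure lborel (convex hull {vec2 x, vec2 y, vec2 z})"
proof -
  let ?K = "convex hull {x, y, z}"
  have K: "closed ?K" 
    by (intro compact_imp_closed finite_imp_compact_convex_hull) auto
  have im: "convex hull {vec2 x, vec2 y, vec2 z} = vec2 ` ?K"
    by (simp add: convex_hull_linear_image[OF linear_vec2])
  have K': "closed (vec2 ` ?K)"
    unfolding im[symmetric] by (intro compact_imp_closed finite_imp_compact_convex_hull) auto
  have meas: "vec2 \<in> borel_measurable lborel"
    using borel_measurable_continuous_onI[OF linear_continuous_on] linear_vec2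
    by (simp add: linear_conv_bounded_linear)
  have "measure lborel (vec2 ` ?K) = measure (distr lborel borel vec2) (vec2 ` ?K)"
    by (subst lborel_vec2) simp
  also have "\<dots> = measure lborel (vec2 -` vec2 ` ?K)"
    using meas K' by (subst measure_distr) auto
  also have "vec2 -` vec2 ` ?K = ?K"
    by (intro inj_vimage_image_eq inj_vec2)
  also have "measure lborel ?K = measure lebesgue ?K"
    using K by (intro measure_completion[symmetric]) auto
  finally show ?thesis by (simp add: im)
qed

lemma measure_triangle: "measure lebesgue (convex hull {x, y, z}) = \<bar>orient x y z\<bar> / 2"
  by (simp add: measure_triangle_vec2 content_triangle orient_def algebra_simps abs_minus_commute)

lemma heron_complex:
  fixes x y z :: complex
  defines "s \<equiv> (dist y z + dist x z + dist x y) / 2"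
  shows "measure lebesgue (convex hull {x, y, z}) =
    sqrt (s * (s - dist y z) * (s - dist x z) * (s - dist x y))"
  unfolding measure_triangle_vec2 heron dist_vec2 s_def ..

subsection \<open>The boundary as frontier of the convex hull\<close>

lemma supporting_direction_orient:
  assumes "a \<bullet> p = a \<bullet> q" "p \<noteq> q" "a \<noteq> 0"
  obtains l where "l \<noteq> 0" "\<And>y. a \<bullet> y - a \<bullet> p = l * orient p q y"
proof
  define d where "d = q - p"
  define l where "l = orient p q (p + a) / (cmod d)\<^sup>2"
  have d: "(cmod d)\<^sup>2 \<noteq> 0" "a \<bullet> d = 0"
    using assms by (simp_all add: d_def inner_diff_right)
  have eq: "a \<bullet> y - a \<bullet> p = l * orient p q y" for y
  proof -
    define e where "e = y - p"
    have "(a \<bullet> e) * (cmod d)\<^sup>2 = Im (cnj d * a) * Im (cnj d * e)"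
      using d(2) unfolding cmod_power2 inner_complex_def
      by (simp add: power2_eq_square) algebra
    then show ?thesis
      using d(1) by (simp add: l_def orient_def d_def e_def inner_diff_right field_simps)
  qed
  then show "a \<bullet> y - a \<bullet> p = l * orient p q y" for y .
  show "l \<noteq> 0"
    using eq[of "p + a"] assms(3) by (auto simp: inner_add_right)
qed

lemma extreme_chord_subset_frontier:
  assumes "p \<in> S" "q \<in> S" "p \<noteq> q" "extreme_chord S p q"
  shows "closed_segment p q \<subseteq> frontier (convex hull S)"
proof
  fix x assume x: "x \<in> closed_segment p q"
  have xK: "x \<in> convex hull S"
    using x assms by (metis closed_segment_subset convex_convex_hull hull_inc subsetD)
  define a where "a = \<i> * (q - p)"
  have ax: "a \<bullet> x = a \<bullet> p"
  proof -
    have "orient p q x = 0" using x unfolding in_segment by (auto simp: orient_affine)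
    then show ?thesis by (simp add: orient_inner a_def)
  qed
  have a: "a \<noteq> 0" using assms by (simp add: a_def)
  have or: "orient p q y = a \<bullet> y - a \<bullet> p" for y by (simp add: orient_inner a_def)
  from assms(4) have "S \<subseteq> {y. a \<bullet> y \<le> a \<bullet> x} \<or> S \<subseteq> {y. a \<bullet> y \<ge> a \<bullet> x}"
    unfolding extreme_chord_def
  proof
    assume *: "\<forall>x\<in>S - {p, q}. 0 < orient p q x"
    have "0 \<le> orient p q y" if "y \<in> S" for y
      using * that by (cases "y \<in> {p, q}") (auto simp: less_imp_le)
    then show ?thesis by (auto simp: or ax)
  next
    assume *: "\<forall>x\<in>S - {p, q}. orient p q x < 0"
    have "orient p q y \<le> 0" if "y \<in> S" for y
      using * that by (cases "y \<in> {p, q}") (auto simp: less_imp_le)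
    then show ?thesis by (auto simp: or ax)
  qed
  then have "convex hull S \<subseteq> {y. a \<bullet> y \<le> a \<bullet> x} \<or> convex hull S \<subseteq> {y. a \<bullet> y \<ge> a \<bullet> x}"
    using hull_minimal[of S _ convex, OF _ convex_halfspace_le]
      hull_minimal[of S _ convex, OF _ convex_halfspace_ge] by metis
  then have "x \<notin> interior (convex hull S)"
  proof
    assume "convex hull S \<subseteq> {y. a \<bullet> y \<le> a \<bullet> x}"
    from interior_mono[OF this] show ?thesis using a by auto
  next
    assume "convex hull S \<subseteq> {y. a \<bullet> y \<ge> a \<bullet> x}"
    from interior_mono[OF this] show ?thesis using a by auto
  qed
  then show "x \<in> frontier (convex hull S)"
    using xK closure_subset by (auto simp: frontier_def)
qed

lemma convex_hull_supporting_hyperplane: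
  fixes S :: "'a::euclidean_space set"
  assumes "finite S" "x \<in> convex hull S" "\<And>y. y \<in> S \<Longrightarrow> a \<bullet> x \<le> a \<bullet> y"
  shows "x \<in> convex hull {y \<in> S. a \<bullet> y = a \<bullet> x}"
proof -
  define T where "T = {y \<in> S. a \<bullet> y = a \<bullet> x}"
  obtain u where u: "\<And>y. y \<in> S \<Longrightarrow> 0 \<le> u y" "sum u S = 1" "(\<Sum>y\<in>S. u y *\<^sub>R y) = x"
    using assms(2) unfolding convex_hull_finite[OF assms(1)] by blast
  have "(\<Sum>y\<in>S. u y * (a \<bullet> y - a \<bullet> x)) = a \<bullet> (\<Sum>y\<in>S. u y *\<^sub>R y) - sum u S * (a \<bullet> x)"
    by (simp add: inner_sum_right right_diff_distrib sum_subtractf sum_distrib_right)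
  then have "(\<Sum>y\<in>S. u y * (a \<bullet> y - a \<bullet> x)) = 0"
    using u by simp
  then have "\<forall>y\<in>S. u y * (a \<bullet> y - a \<bullet> x) = 0"
    using assms u(1) by (subst (asm) sum_nonneg_eq_0_iff) auto
  then have 0: "u y = 0" if "y \<in> S - T" for y
    using that by (auto simp: T_def)
  have "T \<subseteq> S" by (auto simp: T_def)
  then have "sum u T = 1" "(\<Sum>y\<in>T. u y *\<^sub>R y) = x"
    using u 0 sum.mono_neutral_left[OF assms(1) \<open>T \<subseteq> S\<close>, of u]
      sum.mono_neutral_left[OF assms(1) \<open>T \<subseteq> S\<close>, of "\<lambda>y. u y *\<^sub>R y"] by auto
  moreover have "finite T" using \<open>T \<subseteq> S\<close> assms(1) finite_subset by blast
  ultimately have "x \<in> convex hull T"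
    using \<open>T \<subseteq> S\<close> u(1) unfolding convex_hull_finite[OF \<open>finite T\<close>] by blast
  then show ?thesis by (simp only: T_def)
qed

context inscribed_polygon
begin

lemma boundary_eq: "boundary n v = (\<Union>i. closed_segment (V i) (V (Suc i)))"
proof (rule subset_antisym; rule subsetI)
  fix x assume "x \<in> boundary n v"
  then show "x \<in> (\<Union>i. closed_segment (V i) (V (Suc i)))"
    by (auto simp: boundary_def side_eq)
next
  fix x assume "x \<in> (\<Union>i. closed_segment (V i) (V (Suc i)))"
  then obtain i where "x \<in> closed_segment (V (i mod n)) (V (Suc (i mod n)))"
    unfolding V_mod by blast
  moreover have "i mod n < n" using n_ge_3 by simp
  ultimately show "x \<in> boundary n v"
    unfolding boundary_def side_eq by blast
qed

lemma orient_V_012: "orient (V 0) (V 1) (V 2) \<noteq> 0"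
  using orient_zero_circle[of "V 0" c r "V 1" "V 2"] V_on_circle
    V_add_eq_iff[of 0 1 0] V_add_eq_iff[of 2 0 0] V_add_eq_iff[of 2 1 0] n_ge_3
  by (auto simp: numeral_2_eq_2)

lemma interior_hull_nonempty: "interior (convex hull (range V)) \<noteq> {}"
proof
  assume "interior (convex hull (range V)) = {}"
  then obtain a b where a: "a \<noteq> 0" and sub: "convex hull (range V) \<subseteq> {x. a \<bullet> x = b}"
    using empty_interior_subset_hyperplane[OF convex_convex_hull] by metis
  have eq: "a \<bullet> V i = b" for i
    using sub hull_inc[of "V i" "range V" convex] by auto
  have "V 0 \<noteq> V 1" using V_Suc_neq(2)[of 0] by simp
  then obtain l where "l \<noteq> 0" "\<And>y. a \<bullet> y - a \<bullet> V 0 = l * orient (V 0) (V 1) y"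
    using supporting_direction_orient[of a "V 0" "V 1"] eq a by metis
  from this(2)[of "V 2"] \<open>l \<noteq> 0\<close> show False
    using orient_V_012 by (simp add: eq)
qed

lemma V_pred: "V (Suc (i + n - 1)) = V i"
  using n_ge_3 by (simp add: vertex_def)

lemma frontier_hull_eq_boundary: "frontier (convex hull (range V)) = boundary n v"
proof (rule subset_antisym; rule subsetI)
  fix x assume "x \<in> boundary n v"
  then obtain i where "x \<in> closed_segment (V i) (V (Suc i))"
    unfolding boundary_eq by blast
  then show "x \<in> frontier (convex hull (range V))"
    using extreme_chord_subset_frontier[OF _ _ V_Suc_neq(2) extreme_side] by blast
next
  fix x assume x: "x \<in> frontier (convex hull (range V))"
  have "compact (convex hull (range V))"
    by (intro finite_imp_compact_convex_hull finite_range_V)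
  then have xK: "x \<in> convex hull (range V)"
    using x frontier_subset_compact by blast
  have "x \<notin> rel_interior (convex hull (range V))"
    using x rel_interior_nonempty_interior[OF interior_hull_nonempty] by (simp add: frontier_def)
  then obtain a where a: "a \<noteq> 0" and le: "\<And>y. y \<in> convex hull (range V) \<Longrightarrow> a \<bullet> x \<le> a \<bullet> y"
    using supporting_hyperplane_rel_boundary[OF convex_convex_hull xK] by metis
  define T where "T = {y \<in> range V. a \<bullet> y = a \<bullet> x}"
  have leV: "a \<bullet> x \<le> a \<bullet> y" if "y \<in> range V" for y
    using le hull_inc that by metis
  have xT: "x \<in> convex hull T"
    unfolding T_def by (intro convex_hull_supporting_hyperplane finite_range_V xK leV)
  then obtain p where p: "p \<in> T" by fastforce
  then obtain i where i: "p = V i" by (auto simp: T_def)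
  show "x \<in> boundary n v"
  proof (cases "T = {p}")
    case True
    then have "x = V i" using xT i by simp
    then have "x \<in> closed_segment (V i) (V (Suc i))" by simp
    then show ?thesis unfolding boundary_eq by blast
  next
    case False
    with p obtain q where q: "q \<in> T" "q \<noteq> p" by blast
    have apq: "a \<bullet> p = a \<bullet> x" "a \<bullet> q = a \<bullet> x" using p q by (auto simp: T_def)
    then obtain l where l: "l \<noteq> 0" "\<And>y. a \<bullet> y - a \<bullet> p = l * orient p q y"
      using supporting_direction_orient[of a p q] q(2) a by metis
    have circ: "cmod (y - c) = r" if "y \<in> range V" for y
      using that V_on_circle by blast
    have T: "y \<in> {p, q}" if "y \<in> T" for y
    proof -
      have "orient p q y = 0" using l(1) l(2)[of y] that apq by (simp add: T_def)
      then show ?thesis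
        using orient_zero_circle[of p c r q y] circ p q that by (auto simp: T_def)
    qed
    then have "T \<subseteq> {p, q}" by blast
    then have "x \<in> closed_segment p q"
      using xT hull_mono[of T "{p, q}" convex] by (auto simp: segment_convex_hull)
    have pos: "l * orient p q y > 0" if "y \<in> range V - {p, q}" for y
    proof -
      have "y \<notin> T" using T that by blast
      then have "a \<bullet> y > a \<bullet> x" using that leV[of y] by (auto simp: T_def)
      then show ?thesis using l(2)[of y] apq by simp
    qed
    have ext: "extreme_chord (range V) p q"
    proof (cases "l > 0")
      case True
      then have "orient p q y > 0" if "y \<in> range V - {p, q}" for y
        using pos[OF that] by (simp add: zero_less_mult_iff)
      then show ?thesis unfolding extreme_chord_def by blast
    next
      case False
      then have "orient p q y < 0" if "y \<in> range V - {p, q}" for y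
        using pos[OF that] by (simp add: zero_less_mult_iff)
      then show ?thesis unfolding extreme_chord_def by blast
    qed
    define j where "j = i + n - 1"
    have j: "V (Suc j) = V i" unfolding j_def by (rule V_pred)
    have "extreme_chord (range V) (V i) (V j)"
      using extreme_side[of j] unfolding j by (simp add: extreme_chord_commute)
    moreover have "V (Suc i) \<noteq> V j"
      using V_add_eq_iff[of 1 "n - 1" i] n_ge_3 by (auto simp: j_def)
    moreover have "V j \<noteq> V i" using V_Suc_neq(2)[of j] j by simp
    ultimately have "q = V (Suc i) \<or> q = V j"
      using extreme_chord_at_most_two[of "V (Suc i)" "range V" "V j" q "V i"]
        extreme_side[of i] ext q V_Suc_neq i by (auto simp: T_def)
    then have "x \<in> closed_segment (V i) (V (Suc i)) \<or> x \<in> closed_segment (V j) (V (Suc j))"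
      using \<open>x \<in> closed_segment p q\<close> i j by (auto simp: closed_segment_commute)
    then show ?thesis unfolding boundary_eq by blast
  qed
qed

lemma inside_boundary: "inside (boundary n v) = interior (convex hull (range V))"
  using inside_frontier_eq_interior[of "convex hull (range V)"] finite_range_V
  by (simp add: frontier_hull_eq_boundary[symmetric] finite_imp_bounded_convex_hull)

lemma convex_inside_boundary: "convex (inside (boundary n v))"
  by (simp add: inside_boundary convex_interior)

lemma area_eq_measure_hull: "area n v = measure lebesgue (convex hull (range V))"
  unfolding area_def inside_boundary
  by (intro measure_interior negligible_convex_frontier convex_convex_hull
      finite_imp_bounded_convex_hull finite_range_V)

lemma area_pos: "area n v > 0"
proof -
  let ?I = "interior (convex hull (range V))"
  have "?I \<in> lmeasurable"
    by (intro lmeasurable_interior finite_imp_bounded_convex_hull finite_range_V)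
  moreover have "\<not> negligible ?I"
    by (intro open_not_negligible open_interior interior_hull_nonempty)
  ultimately have "measure lebesgue ?I \<noteq> 0"
    using negligible_iff_measure0 by blast
  then show ?thesis
    unfolding area_def inside_boundary by (simp add: zero_less_measure_iff)
qed

end

subsection \<open>Regular polygons\<close>

lemma negligible_closed_segment_complex: "negligible (closed_segment (x :: complex) y)"
proof -
  have "closed_segment x y \<in> lmeasurable"
    by (simp add: segment_convex_hull measurable_convex finite_imp_bounded_convex_hull)
  moreover have "measure lebesgue (closed_segment x y) = 0"
    using measure_triangle[of x x y] by (simp add: segment_convex_hull)
  ultimately show ?thesis by (simp add: negligible_iff_measure0)
qed

lemma Im_chord_cis:
  "Im (cnj (cis (2 * x) - 1) * (cis (2 * y) - 1)) = 4 * sin x * sin y * sin (y - x)"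
proof -
  have "Im (cnj (cis (2 * x) - 1) * (cis (2 * y) - 1)) =
      cos (2 * x) * sin (2 * y) - sin (2 * x) * cos (2 * y) + sin (2 * x) - sin (2 * y)"
    by (simp add: algebra_simps)
  also have "\<dots> = 4 * sin x * sin y * sin (y - x)"
    unfolding sin_double cos_double_sin sin_diff by (simp add: algebra_simps power2_eq_square)
  finally show ?thesis .
qed

lemma frontier_ray_unique:
  fixes K :: "'a::euclidean_space set"
  assumes "convex K" "c \<in> interior K" "y \<in> frontier K" "y' \<in> frontier K"
    and "c + s *\<^sub>R (y - c) = c + s' *\<^sub>R (y' - c)" "0 < s" "0 < s'"
  shows "y = y'"
proof -
  have less: False if "s < s'" "0 < s" "0 < s'" "y \<in> frontier K" "y' \<in> frontier K"
    and eq: "c + s *\<^sub>R (y - c) = c + s' *\<^sub>R (y' - c)" for s s' y y'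
  proof -
    have "y' - c = (s / s') *\<^sub>R (y - c)"
    proof -
      have "(s / s') *\<^sub>R (y - c) = (1 / s') *\<^sub>R (s *\<^sub>R (y - c))" by simp
      also have "\<dots> = (1 / s') *\<^sub>R (s' *\<^sub>R (y' - c))" using eq by simp
      finally show ?thesis using that by simp
    qed
    then have "y' = y - (1 - s / s') *\<^sub>R (y - c)"
      by (simp add: algebra_simps)
    moreover have "y - (1 - s / s') *\<^sub>R (y - c) \<in> interior K"
      using assms that by (intro mem_interior_closure_convex_shrink) (auto simp: frontier_def)
    ultimately show False using that by (auto simp: frontier_def)
  qed
  have "s = s'"
    using less[of s s' y y'] less[of s' s y' y] assms by (metis linorder_cases)
  then show ?thesis using assms by simp
qed

context inscribed_polygon
begin

lemma area_fan:
  assumes q: "q \<in> interior (convex hull (range V))"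
  shows "area n v = (\<Sum>i<n. \<bar>orient q (V i) (V (Suc i))\<bar> / 2)"
proof -
  let ?K = "convex hull (range V)"
  define T where "T i = convex hull {q, V i, V (Suc i)}" for i
  have bounded: "bounded ?K" by (intro finite_imp_bounded_convex_hull finite_range_V)
  have T: "\<exists>s\<ge>0. s \<le> 1 \<and> (\<exists>y\<in>closed_segment (V i) (V (Suc i)). x = q + s *\<^sub>R (y - q))"
    if x: "x \<in> T i" for x i
  proof -
    have "x \<in> convex hull (insert q {V i, V (Suc i)})" using x by (simp add: T_def)
    then obtain u s y where "0 \<le> u" "0 \<le> s" "u + s = 1" "y \<in> closed_segment (V i) (V (Suc i))"
      "x = u *\<^sub>R q + s *\<^sub>R y"
      by (subst (asm) convex_hull_insert) (auto simp: segment_convex_hull)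
    moreover from this have "u = 1 - s" "s \<le> 1" by auto
    then have "x = q + s *\<^sub>R (y - q)"
      using \<open>x = u *\<^sub>R q + s *\<^sub>R y\<close> \<open>u = 1 - s\<close> by (simp only: scaleR_left_diff_distrib scaleR_right_diff_distrib) simp
    ultimately show ?thesis using \<open>s \<le> 1\<close> by blast
  qed
  have in_T: "q + s *\<^sub>R (y - q) \<in> T i"
    if "0 \<le> s" "s \<le> 1" "y \<in> closed_segment (V i) (V (Suc i))" for s y i
  proof -
    have "y \<in> T i" unfolding T_def
      using that(3) hull_mono[of "{V i, V (Suc i)}" "{q, V i, V (Suc i)}" convex]
      by (auto simp: segment_convex_hull)
    moreover have "q \<in> T i" by (simp add: T_def hull_inc)
    moreover have "convex (T i)" by (simp add: T_def)
    ultimately have "(1 - s) *\<^sub>R q + s *\<^sub>R y \<in> T i"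
      using that by (auto simp: convex_alt)
    then show ?thesis by (simp add: algebra_simps)
  qed
  have fr: "y \<in> frontier ?K" if "y \<in> closed_segment (V i) (V (Suc i))" for y i
    using that unfolding frontier_hull_eq_boundary boundary_eq by blast
  have "?K = (\<Union>i<n. T i)"
  proof (rule subset_antisym; rule subsetI)
    fix x assume x: "x \<in> ?K"
    show "x \<in> (\<Union>i<n. T i)"
    proof (cases "x = q")
      case True
      then have "x \<in> T 0" by (simp add: T_def hull_inc)
      then show ?thesis using n_ge_3 by auto
    next
      case False
      then obtain d where d: "0 < d" "q + d *\<^sub>R (x - q) \<in> frontier ?K"
        using ray_to_frontier[OF bounded q, of "x - q"] by auto
      have "d \<ge> 1"
      proof (rule ccontr)
        assume "\<not> ?thesis"
        then have "x - (1 - d) *\<^sub>R (x - q) \<in> interior ?K"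
          using x q d by (intro mem_interior_convex_shrink) auto
        then show False using d by (simp add: frontier_def algebra_simps)
      qed
      obtain i where i: "i < n" "q + d *\<^sub>R (x - q) \<in> closed_segment (V i) (V (Suc i))"
        using d(2) unfolding frontier_hull_eq_boundary boundary_def side_eq by blast
      have "q + (1 / d) *\<^sub>R (q + d *\<^sub>R (x - q) - q) \<in> T i"
        using i \<open>d \<ge> 1\<close> by (intro in_T) auto
      then show ?thesis using i \<open>0 < d\<close> by auto
    qed
  next
    fix x assume "x \<in> (\<Union>i<n. T i)"
    then obtain i where "x \<in> T i" by blast
    moreover have "T i \<subseteq> ?K"
      unfolding T_def using q interior_subset[of ?K]
      by (intro hull_minimal) (auto simp: hull_inc)
    ultimately show "x \<in> ?K" by blast
  qed
  moreover have "negligible (T i \<inter> T j)" if "i < n" "j < n" "i \<noteq> j" for i j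
  proof -
    have "T i \<inter> T j \<subseteq> closed_segment q (V i) \<union> closed_segment q (V (Suc i))"
    proof
      fix x assume "x \<in> T i \<inter> T j"
      then obtain s y s' y' where s: "0 \<le> s" "s \<le> 1" "y \<in> closed_segment (V i) (V (Suc i))"
          "x = q + s *\<^sub>R (y - q)" "0 \<le> s'" "y' \<in> closed_segment (V j) (V (Suc j))"
          "x = q + s' *\<^sub>R (y' - q)"
        using T[of x i] T[of x j] by blast
      show "x \<in> closed_segment q (V i) \<union> closed_segment q (V (Suc i))"
      proof (cases "s = 0 \<or> s' = 0")
        case True
        then have "x = q" using s by auto
        then show ?thesis by simp
      next
        case False
        then have "y = y'"
          using frontier_ray_unique[OF convex_convex_hull q fr fr, of y i y' j s s'] s by auto
        then have "y \<in> {V i, V (Suc i)}"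
          using sides_meet[of i j] that s by auto
        moreover have "x \<in> closed_segment q y"
          unfolding in_segment s(4) using s(1,2)
          by (intro exI[of _ s]) (simp add: scaleR_left_diff_distrib scaleR_right_diff_distrib)
        ultimately show ?thesis by auto
      qed
    qed
    then show ?thesis
      using negligible_subset negligible_Un negligible_closed_segment_complex by metis
  qed
  moreover have "T i \<in> lmeasurable" for i
    unfolding T_def by (intro measurable_convex finite_imp_bounded_convex_hull) auto
  ultimately have "measure lebesgue ?K = (\<Sum>i<n. measure lebesgue (T i))"
    using measure_negligible_finite_Union_image[of "{..<n}" T] by (simp add: pairwise_def)
  then show ?thesis
    by (simp add: area_eq_measure_hull T_def measure_triangle)
qed

lemma side_length_eq: "side_length n v i = cmod (V (Suc i) - V i)"
  by (simp add: side_length_def dist_norm norm_minus_commute)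

lemma side_length_mod: "side_length n v (i mod n) = side_length n v i"
  by (simp add: side_length_eq V_mod)

text \<open>Two consecutive chords of equal length leaving a vertex must turn in the same direction,
  since otherwise the second one would lead back.\<close>

lemma equal_sides_geometric:
  assumes eq: "\<And>i j. i < n \<Longrightarrow> j < n \<Longrightarrow> side_length n v i = side_length n v j"
  obtains p w where "\<And>i. V i = c + p * w ^ i" "cmod p = r" "cmod w = 1" "w ^ n = 1" "w \<noteq> 1"
proof
  define u where "u i = V i - c" for i
  define w where "w i = u (Suc i) / u i" for i
  have u: "cmod (u i) = r" "u i \<noteq> 0" for i
    using V_on_circle[of i] radius_pos by (auto simp: u_def)
  have w: "cmod (w i) = 1" "u (Suc i) = w i * u i" for i
    using u radius_pos by (simp_all add: w_def norm_divide)
  have sl: "side_length n v i = side_length n v 0" for i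
    using eq[of "i mod n" 0] n_ge_3 side_length_mod[of i] by auto
  have Re_w: "Re (w i) = Re (w 0)" for i
  proof -
    have "side_length n v i = r * cmod (w i - 1)" for i
    proof -
      have "V (Suc i) - V i = u i * (w i - 1)"
        using w(2)[of i] by (simp add: u_def algebra_simps)
      then show ?thesis using u by (simp add: side_length_eq norm_mult)
    qed
    then have "cmod (w i - 1) = cmod (w 0 - 1)"
      using sl[of i] radius_pos by simp
    then have "(cmod (w i - 1))\<^sup>2 = (cmod (w 0 - 1))\<^sup>2" by simp
    moreover have "(cmod (w i - 1))\<^sup>2 = 2 - 2 * Re (w i)" for i
    proof -
      have "(cmod (w i))\<^sup>2 = 1" using w by simp
      then show ?thesis unfolding cmod_power2 by (simp add: power2_eq_square algebra_simps)
    qed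
    ultimately show ?thesis by simp
  qed
  have step: "w (Suc i) = w i" for i
  proof (rule ccontr)
    assume ne: "w (Suc i) \<noteq> w i"
    have "(cmod (w (Suc i)))\<^sup>2 = (cmod (w i))\<^sup>2" using w by simp
    then have "(Im (w (Suc i)))\<^sup>2 = (Im (w i))\<^sup>2"
      unfolding cmod_power2 using Re_w[of i] Re_w[of "Suc i"] by simp
    with ne have "Im (w (Suc i)) = - Im (w i)"
      using Re_w[of i] Re_w[of "Suc i"] by (auto simp: power2_eq_iff complex_eq_iff)
    then have "w (Suc i) = cnj (w i)"
      using Re_w[of i] Re_w[of "Suc i"] by (simp add: complex_eq_iff)
    then have "w (Suc i) * w i = of_real ((cmod (w i))\<^sup>2)"
      unfolding complex_norm_square by (simp add: mult.commute)
    then have "u (Suc (Suc i)) = u i"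
      using w(1)[of i] w(2)[of i] w(2)[of "Suc i"] by (simp add: mult.assoc[symmetric])
    then show False using V_Suc_neq(3)[of i] by (simp add: u_def)
  qed
  have w0: "w i = w 0" for i
    by (induction i) (simp_all add: step)
  have u_pow: "u i = u 0 * w 0 ^ i" for i
  proof (induction i)
    case (Suc i)
    have "u (Suc i) = w 0 * u i" using w(2)[of i] w0[of i] by simp
    then show ?case using Suc by simp
  qed simp
  then show "V i = c + u 0 * w 0 ^ i" for i
    by (metis add_diff_cancel_left' diff_add_cancel add.commute u_def)
  have "u n = u 0" by (simp add: u_def vertex_def)
  then show "w 0 ^ n = 1" using u_pow[of n] u(2)[of 0] by simp
  show "cmod (u 0) = r" "cmod (w 0) = 1" using u w by auto
  show "w 0 \<noteq> 1" using w(2)[of 0] V_Suc_neq(1)[of 0] by (auto simp: u_def)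
qed

lemma regular_polygon_iff_equal_sides:
  "regular_polygon n v \<longleftrightarrow> (\<forall>i<n. \<forall>j<n. side_length n v i = side_length n v j)"
proof
  assume eq: "\<forall>i<n. \<forall>j<n. side_length n v i = side_length n v j"
  obtain p w where pw: "\<And>i. V i = c + p * w ^ i" "cmod p = r" "cmod w = 1"
    using equal_sides_geometric eq by metis
  have "angle_at (V i) (V (i + 1)) (V (i + 2)) =
      arccos (((1 - w) \<bullet> (w\<^sup>2 - w)) / (cmod (1 - w) * cmod (w\<^sup>2 - w)))" for i
  proof -
    define k where "k = p * w ^ i"
    have k: "cmod k = r" using pw by (simp add: k_def norm_mult norm_power)
    have *: "V i - V (i + 1) = k * (1 - w)" "V (i + 2) - V (i + 1) = k * (w\<^sup>2 - w)"
      by (simp_all add: pw k_def algebra_simps power2_eq_square)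
    have "(k * x) \<bullet> (k * y) = r\<^sup>2 * (x \<bullet> y)" for x y
      unfolding k[symmetric] cmod_power2 inner_complex_def
      by (simp add: power2_eq_square algebra_simps)
    then show ?thesis
      unfolding angle_at_def * using k radius_pos by (simp add: norm_mult power2_eq_square)
  qed
  then have "\<forall>i<n. \<forall>j<n. angle_at (V i) (V (i + 1)) (V (i + 2)) =
      angle_at (V j) (V (j + 1)) (V (j + 2))"
    by presburger
  then show "regular_polygon n v"
    unfolding regular_polygon_def using polygon convex_inside_boundary eq by blast
next
  assume "regular_polygon n v"
  then show "\<forall>i<n. \<forall>j<n. side_length n v i = side_length n v j"
    unfolding regular_polygon_def by blast
qed

text \<open>For \<open>1 < k < n - 1\<close> the chord from \<open>1\<close> to \<open>cis (2 * pi * k / n)\<close> separates two \<open>n\<close>-th roots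
  of unity, so star polygons are not simple.\<close>

lemma equal_sides_root_of_unity:
  assumes V: "\<And>i. V i = c + p * w ^ i" and p: "cmod p = r" and w: "w ^ n = 1" "w \<noteq> 1"
  shows "Re w = cos (2 * (pi / n)) \<and> \<bar>Im w\<bar> = sin (2 * (pi / n))"
proof -
  have n: "n > 0" using n_ge_3 by simp
  define \<zeta> where "\<zeta> k = cis (2 * (pi * k / n))" for k :: nat
  have bij: "bij_betw \<zeta> {..<n} {z. z ^ n = 1}"
    using Complex.bij_betw_roots_unity[OF n] unfolding \<zeta>_def by (simp add: mult.assoc)
  then obtain k where k: "k < n" "w = \<zeta> k"
    using w unfolding bij_betw_def by blast
  have inj: "inj_on ((^) w) {..<n}"
    by (rule inj_onI) (use V V_add_eq_iff[of _ _ 0] in auto)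
  have roots: "(^) w ` {..<n} = {z. z ^ n = 1}"
  proof (rule card_subset_eq)
    show "finite {z::complex. z ^ n = 1}" using n finite_roots_unity[of n] by simp
    show "(^) w ` {..<n} \<subseteq> {z. z ^ n = 1}"
    proof
      fix z assume "z \<in> (^) w ` {..<n}"
      then obtain i where "z = w ^ i" by blast
      then have "z ^ n = (w ^ n) ^ i" by (simp only: power_mult[symmetric] mult.commute)
      then show "z \<in> {z. z ^ n = 1}" using w by simp
    qed
    show "card ((^) w ` {..<n}) = card {z::complex. z ^ n = 1}"
      using inj n by (simp add: card_image card_roots_unity_eq)
  qed
  have on: "c + p * \<zeta> j \<in> range V" if "j < n" for j
  proof -
    have "\<zeta> j \<in> {z. z ^ n = 1}" using bij that unfolding bij_betw_def by blast
    then obtain i where "\<zeta> j = w ^ i" using roots by blast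
    then show ?thesis using V by (metis rangeI)
  qed
  have or: "orient (V 0) (V (Suc 0)) (c + p * \<zeta> j) =
      4 * r\<^sup>2 * (sin (pi * k / n) * sin (pi * j / n) * sin (pi * j / n - pi * k / n))" for j
  proof -
    have "orient (V 0) (V (Suc 0)) (c + p * \<zeta> j) = Im (cnj p * p * (cnj (w - 1) * (\<zeta> j - 1)))"
      unfolding V orient_def by (simp add: algebra_simps)
    also have "cnj p * p = of_real (r\<^sup>2)"
      using p complex_norm_square[of p] by (simp add: mult.commute)
    also have "Im (of_real (r\<^sup>2) * (cnj (w - 1) * (\<zeta> j - 1))) = r\<^sup>2 * Im (cnj (w - 1) * (\<zeta> j - 1))"
      by simp
    finally show ?thesis
      unfolding k(2) \<zeta>_def Im_chord_cis by (simp only: mult_ac)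
  qed
  have "k \<noteq> 0"
  proof
    assume "k = 0"
    with k w show False by (simp add: \<zeta>_def)
  qed
  have "k = 1 \<or> k = n - 1"
  proof (rule ccontr)
    assume "\<not> ?thesis"
    then have k': "1 < k" "k < n - 1" using k \<open>k \<noteq> 0\<close> by auto
    have sin: "sin (pi * j / n) > 0" if "0 < j" "j < n" for j :: nat
      using that by (intro sin_gt_zero) (auto simp: field_simps)
    have s1: "sin (pi * real 1 / n - pi * k / n) < 0"
    proof -
      have "sin (pi * real (k - 1) / n) > 0" using k' by (intro sin) auto
      moreover have "pi * real (k - 1) / n = - (pi * real 1 / n - pi * k / n)"
        using k' by (simp add: of_nat_diff field_simps)
      ultimately show ?thesis by (metis sin_minus neg_0_less_iff_less)
    qed
    have s2: "sin (pi * real (n - 1) / n - pi * k / n) > 0"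
    proof -
      have "sin (pi * real (n - 1 - k) / n) > 0" using k' by (intro sin) auto
      moreover have "pi * real (n - 1 - k) / n = pi * real (n - 1) / n - pi * k / n"
        using k' by (simp add: of_nat_diff field_simps)
      ultimately show ?thesis by metis
    qed
    have neg: "orient (V 0) (V (Suc 0)) (c + p * \<zeta> 1) < 0"
      unfolding or using s1 sin[of k] sin[of 1] k' radius_pos by (simp add: mult_less_0_iff)
    then have x1: "c + p * \<zeta> 1 \<in> range V - {V 0, V (Suc 0)}"
      using on[of 1] k' by auto
    have pos: "orient (V 0) (V (Suc 0)) (c + p * \<zeta> (n - 1)) > 0"
      unfolding or using s2 sin[of k] sin[of "n - 1"] k' radius_pos by (simp add: zero_less_mult_iff)
    then have x2: "c + p * \<zeta> (n - 1) \<in> range V - {V 0, V (Suc 0)}"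
      using on[of "n - 1"] k' by auto
    from extreme_side[of 0] neg pos show False
      unfolding extreme_chord_def using x1 x2 less_asym by blast
  qed
  then show ?thesis
  proof
    assume "k = 1"
    moreover have "sin (2 * (pi / n)) \<ge> 0"
      using n_ge_3 by (intro sin_ge_zero) (auto simp: field_simps)
    ultimately show ?thesis using k by (simp add: \<zeta>_def)
  next
    assume k1: "k = n - 1"
    have "2 * (pi * real (n - 1) / n) = 2 * pi - 2 * (pi / n)"
      using n_ge_3 by (simp add: of_nat_diff field_simps)
    moreover have "sin (2 * (pi / n)) \<ge> 0"
      using n_ge_3 by (intro sin_ge_zero) (auto simp: field_simps)
    ultimately show ?thesis using k k1 by (simp add: \<zeta>_def cos_diff sin_diff)
  qed
qed

lemma regular_polygon_formulas:
  assumes "regular_polygon n v"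
  shows "area n v = real n * r\<^sup>2 * sin (pi / n) * cos (pi / n)"
    and "side_length n v i = 2 * r * sin (pi / n)"
proof -
  obtain p w where pw: "\<And>i. V i = c + p * w ^ i" "cmod p = r" "cmod w = 1" "w ^ n = 1" "w \<noteq> 1"
    using equal_sides_geometric assms regular_polygon_iff_equal_sides by metis
  have w: "Re w = cos (2 * (pi / n))" "\<bar>Im w\<bar> = sin (2 * (pi / n))"
    using equal_sides_root_of_unity[OF pw(1,2,4,5)] by auto
  have n: "n > 0" using n_ge_3 by simp
  have or: "orient c (V i) (V (Suc i)) = r\<^sup>2 * Im w" for i
  proof -
    define k where "k = p * w ^ i"
    have "cmod k = r" using pw by (simp add: k_def norm_mult norm_power)
    have "orient c (V i) (V (Suc i)) = Im (cnj k * k * w)"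
      unfolding pw orient_def k_def by (simp add: algebra_simps)
    also have "cnj k * k = of_real (r\<^sup>2)"
      using \<open>cmod k = r\<close> complex_norm_square[of k] by (simp add: mult.commute)
    finally show ?thesis by simp
  qed
  have sin: "sin (2 * (pi / n)) > 0"
    using n_ge_3 by (intro sin_gt_zero) (auto simp: field_simps)
  let ?K = "convex hull (range V)"
  have "c \<in> ?K"
  proof -
    have "(\<Sum>i<n. (1 / real n) *\<^sub>R V i) = c"
    proof -
      have "(\<Sum>i<n. w ^ i) = 0" using pw by (simp add: geometric_sum)
      then have "(\<Sum>i<n. V i) = of_nat n * c"
        by (simp add: pw(1) sum.distrib sum_distrib_left[symmetric])
      then show ?thesis using n by (simp add: scaleR_conv_of_real sum_divide_distrib[symmetric])
    qed
    moreover have "(\<Sum>i<n. (1 / real n) *\<^sub>R V i) \<in> ?K"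
      using n by (intro convex_sum) (auto simp: hull_inc)
    ultimately show ?thesis by simp
  qed
  moreover have "c \<notin> frontier ?K"
  proof
    assume "c \<in> frontier ?K"
    then obtain i where "c \<in> closed_segment (V i) (V (Suc i))"
      unfolding frontier_hull_eq_boundary boundary_eq by blast
    then have "orient (V i) (V (Suc i)) c = 0"
      unfolding in_segment by (auto simp: orient_affine)
    moreover have "orient (V i) (V (Suc i)) c = orient c (V i) (V (Suc i))"
      by (simp add: orient_def algebra_simps)
    ultimately show False using or[of i] sin w radius_pos by auto
  qed
  ultimately have "c \<in> interior ?K"
    using closure_subset by (auto simp: frontier_def)
  then have "area n v = (\<Sum>i<n. \<bar>r\<^sup>2 * Im w\<bar> / 2)"
    by (simp add: area_fan or)
  then show "area n v = real n * r\<^sup>2 * sin (pi / n) * cos (pi / n)"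
    using w unfolding sin_double by (simp add: abs_mult)
  have "V (Suc i) - V i = p * w ^ i * (w - 1)" by (simp add: pw algebra_simps)
  then have "side_length n v i = r * cmod (w - 1)"
    using pw by (simp add: side_length_eq norm_mult norm_power)
  also have "cmod (w - 1) = 2 * sin (pi / n)"
  proof (rule power2_eq_imp_eq)
    have "(cmod w)\<^sup>2 = 1" using pw by simp
    then have "(cmod (w - 1))\<^sup>2 = 2 - 2 * Re w"
      unfolding cmod_power2 by (simp add: power2_eq_square algebra_simps)
    also have "\<dots> = (2 * sin (pi / n))\<^sup>2"
      unfolding w cos_double_sin by (simp add: power2_eq_square)
    finally show "(cmod (w - 1))\<^sup>2 = (2 * sin (pi / n))\<^sup>2" .
    show "0 \<le> 2 * sin (pi / n)"
      using n_ge_3 by (auto intro!: sin_ge_zero simp: field_simps)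
  qed simp
  finally show "side_length n v i = 2 * r * sin (pi / n)" by simp
qed

end

subsection \<open>The inequality\<close>

lemma prod_le_one_if_mean_one:
  fixes x :: "'a \<Rightarrow> real"
  assumes "finite I" "\<And>i. i \<in> I \<Longrightarrow> x i > 0" "sum x I = card I"
  shows "prod x I \<le> 1" and "prod x I = 1 \<longleftrightarrow> (\<forall>i\<in>I. x i = 1)"
proof -
  have pos: "prod x I > 0" using assms by (simp add: prod_pos)
  have ln: "ln (prod x I) = (\<Sum>i\<in>I. ln (x i))"
    using assms by (intro ln_prod) (auto simp: less_imp_neq[symmetric] dest: less_imp_neq)
  have gap: "- ln (prod x I) = (\<Sum>i\<in>I. x i - 1 - ln (x i))"
    by (simp add: ln sum_subtractf assms(3))
  have nonneg: "0 \<le> x i - 1 - ln (x i)" if "i \<in> I" for i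
    using ln_le_minus_one assms(2)[OF that] by simp
  then have "0 \<le> - ln (prod x I)" unfolding gap by (rule sum_nonneg)
  then show "prod x I \<le> 1" using pos by simp
  show "prod x I = 1 \<longleftrightarrow> (\<forall>i\<in>I. x i = 1)"
  proof
    assume "prod x I = 1"
    then have "(\<Sum>i\<in>I. x i - 1 - ln (x i)) = 0" using gap by simp
    then have "\<forall>i\<in>I. x i - 1 - ln (x i) = 0"
      using sum_nonneg_eq_0_iff[OF assms(1) nonneg] by simp
    then show "\<forall>i\<in>I. x i = 1" using ln_eq_minus_one assms(2) by force
  qed simp
qed

lemma dist_le_sum_dist:
  fixes f :: "nat \<Rightarrow> 'a::metric_space"
  assumes "a \<le> b"
  shows "dist (f a) (f b) \<le> (\<Sum>k=a..<b. dist (f k) (f (Suc k)))"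
  using assms
proof (induction b rule: dec_induct)
  case (step b)
  have "dist (f a) (f (Suc b)) \<le> dist (f a) (f b) + dist (f b) (f (Suc b))"
    by (rule dist_triangle)
  then show ?case using step by simp
qed simp

context inscribed_polygon
begin

lemma side_length_pos: "side_length n v i > 0"
  using V_Suc_neq(1)[of i] by (simp add: side_length_eq)

lemma perimeter_shift: "(\<Sum>k=i..<i + n. side_length n v k) = perimeter n v"
proof (induction i)
  case 0
  then show ?case by (simp add: perimeter_def atLeast0LessThan)
next
  case (Suc i)
  have "(\<Sum>k=i..<Suc (i + n). side_length n v k) =
      side_length n v i + (\<Sum>k=Suc i..<Suc (i + n). side_length n v k)"
    by (intro sum.atLeast_Suc_lessThan) simp
  moreover have "side_length n v (i + n) = side_length n v i"
    using side_length_mod[of "i + n"] side_length_mod[of i] by simp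
  ultimately show ?case using Suc by simp
qed

lemma perimeter_pos: "perimeter n v > 0"
  unfolding perimeter_def using n_ge_3 side_length_pos by (intro sum_pos) (auto simp: lessThan_empty_iff)

lemma side_length_less_half_perimeter: "2 * side_length n v i < perimeter n v"
proof -
  have sl: "side_length n v k = dist (V k) (V (Suc k))" for k
    by (simp add: side_length_def)
  have "perimeter n v = side_length n v i + (\<Sum>k=Suc i..<i + n. side_length n v k)"
    using n_ge_3 by (subst perimeter_shift[of i, symmetric]) (intro sum.atLeast_Suc_lessThan, simp)
  also have "(\<Sum>k=Suc i..<i + n. side_length n v k) =
      side_length n v (Suc i) + (\<Sum>k=Suc (Suc i)..<i + n. side_length n v k)"
    using n_ge_3 by (intro sum.atLeast_Suc_lessThan) simp
  also have "(\<Sum>k=Suc (Suc i)..<i + n. side_length n v k) \<ge> dist (V (Suc (Suc i))) (V (i + n))"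
    unfolding sl using n_ge_3 by (intro dist_le_sum_dist) simp
  moreover have "dist (V (Suc (Suc i))) (V (i + n)) = dist (V (Suc (Suc i))) (V i)"
    by (simp add: vertex_def)
  moreover have "dist (V i) (V (Suc i)) < dist (V i) (V (Suc (Suc i))) + dist (V (Suc (Suc i))) (V (Suc i))"
  proof -
    have "orient (V i) (V (Suc i)) (V (Suc (Suc i))) \<noteq> 0"
      using orient_zero_circle V_on_circle V_Suc_neq by metis
    then have "\<not> between (V i, V (Suc i)) (V (Suc (Suc i)))"
      unfolding between_mem_segment in_segment by (auto simp: orient_affine)
    then have "dist (V i) (V (Suc i)) \<noteq> dist (V i) (V (Suc (Suc i))) + dist (V (Suc (Suc i))) (V (Suc i))"
      unfolding between .
    moreover have "dist (V i) (V (Suc i)) \<le> dist (V i) (V (Suc (Suc i))) + dist (V (Suc (Suc i))) (V (Suc i))"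
      by (rule dist_triangle)
    ultimately show ?thesis by linarith
  qed
  ultimately show ?thesis
    using sl[of i] sl[of "Suc i"] dist_commute[of "V i" "V (Suc (Suc i))"]
      dist_commute[of "V (Suc i)" "V (Suc (Suc i))"] by linarith
qed

definition mean_ratio :: real where
  "mean_ratio = root n (\<Prod>i<n. 1 - 2 * side_length n v i / perimeter n v) / (1 - 2 / n)"

lemma pseudo_perimeter_eq: "pseudo_perimeter n v = perimeter n v * mean_ratio"
proof -
  have "real n / (real n - 2) = 1 / (1 - 2 / n)" using n_ge_3 by (simp add: field_simps)
  then show ?thesis by (simp add: pseudo_perimeter_def mean_ratio_def)
qed

lemma mean_pos: "1 - 2 / real n > 0"
  using n_ge_3 by (simp add: field_simps)

lemma one_minus_side_pos: "1 - 2 * side_length n v i / perimeter n v > 0"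
  using side_length_less_half_perimeter perimeter_pos by (simp add: field_simps)

lemma mean_ratio: "0 < mean_ratio" "mean_ratio \<le> 1" "mean_ratio = 1 \<longleftrightarrow> regular_polygon n v"
proof -
  define m where "m = 1 - 2 / real n"
  define t where "t i = 1 - 2 * side_length n v i / perimeter n v" for i
  have n: "n > 0" using n_ge_3 by simp
  have m: "m > 0" using mean_pos by (simp add: m_def)
  have t: "t i > 0" for i using one_minus_side_pos by (simp add: t_def)
  have R: "mean_ratio = root n (prod t {..<n}) / m" by (simp add: mean_ratio_def t_def m_def)
  show pos: "0 < mean_ratio" unfolding R using n m t by (simp add: prod_pos)
  have pow: "mean_ratio ^ n = (\<Prod>i<n. t i / m)"
    unfolding R using n m t by (simp add: power_divide prod_dividef less_imp_le prod_nonneg)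
  have "(\<Sum>i<n. t i) = real n - 2 * (\<Sum>i<n. side_length n v i) / perimeter n v"
    by (simp add: t_def sum_subtractf sum_distrib_left sum_divide_distrib)
  also have "\<dots> = real n * m"
    using perimeter_pos n unfolding perimeter_def[symmetric] m_def by (simp add: field_simps)
  finally have sum: "(\<Sum>i<n. t i / m) = card {..<n}"
    using m by (simp add: sum_divide_distrib[symmetric])
  have posr: "t i / m > 0" for i using t m by simp
  show "mean_ratio \<le> 1"
    using prod_le_one_if_mean_one(1)[of "{..<n}" "\<lambda>i. t i / m", OF _ posr sum] pow n one_less_power
    by (metis finite_lessThan not_less)
  have "mean_ratio = 1 \<longleftrightarrow> mean_ratio ^ n = 1"
    using pos n power_eq_imp_eq_base[of mean_ratio n 1] by auto
  also have "\<dots> \<longleftrightarrow> (\<forall>i<n. t i = m)"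
    using prod_le_one_if_mean_one(2)[of "{..<n}" "\<lambda>i. t i / m", OF _ posr sum] pow m by auto
  also have "\<dots> \<longleftrightarrow> (\<forall>i<n. side_length n v i = perimeter n v / n)"
    using perimeter_pos n by (auto simp: t_def m_def field_simps)
  also have "\<dots> \<longleftrightarrow> (\<forall>i<n. \<forall>j<n. side_length n v i = side_length n v j)"
  proof (intro iffI allI impI)
    fix i assume eq: "\<forall>i<n. \<forall>j<n. side_length n v i = side_length n v j" and i: "i < n"
    have "perimeter n v = (\<Sum>j<n. side_length n v i)"
      unfolding perimeter_def
    proof (intro sum.cong refl)
      fix j assume "j \<in> {..<n}"
      then show "side_length n v j = side_length n v i" using eq i by blast
    qed
    then show "side_length n v i = perimeter n v / n" using n by simp
  next
    fix i j
    assume "\<forall>i<n. side_length n v i = perimeter n v / n" "i < n" "j < n"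
    then show "side_length n v i = side_length n v j" by metis
  qed
  also have "\<dots> \<longleftrightarrow> regular_polygon n v" by (rule regular_polygon_iff_equal_sides[symmetric])
  finally show "mean_ratio = 1 \<longleftrightarrow> regular_polygon n v" .
qed

lemma tan_pos: "tan (pi / n) > 0"
  using n_ge_3 by (intro tan_gt_zero) (auto simp: field_simps)

lemma deficit_difference:
  "(pseudo_perimeter n v)\<^sup>2 * (1 - phi n v / phi0 n) =
    (pseudo_perimeter n v)\<^sup>2 - 4 * (real n * tan (pi / n)) * area n v * mean_ratio powr (2 - n / 2)"
proof -
  define m where "m = 1 - 2 / real n"
  define Q where "Q = (\<Prod>i<n. 1 - 2 * side_length n v i / perimeter n v)"
  have n: "n > 0" using n_ge_3 by simp
  have m: "m > 0" using mean_pos by (simp add: m_def)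
  have Q: "Q > 0" unfolding Q_def using one_minus_side_pos by (intro prod_pos) auto
  have "sqrt Q = Q powr (1 / 2)" using Q by (simp add: powr_half_sqrt)
  also have "\<dots> = root n Q powr (n / 2)"
    using Q n by (simp add: root_powr_inverse powr_powr)
  also have "root n Q = mean_ratio * m"
    using m unfolding mean_ratio_def Q_def[symmetric] m_def[symmetric] by simp
  also have "(mean_ratio * m) powr (n / 2) = mean_ratio powr (n / 2) * m powr (n / 2)"
    using mean_ratio m by (simp add: powr_mult)
  finally have P: "pseudo_area n v = (perimeter n v)\<^sup>2 / 4 * (mean_ratio powr (n / 2) * m powr (n / 2))"
    by (simp add: pseudo_area_def Q_def)
  have "m powr (n / 2) > 0" "mean_ratio powr (n / 2) > 0" using m mean_ratio by auto
  then have ratio: "(perimeter n v)\<^sup>2 * (phi n v / phi0 n) =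
      4 * (real n * tan (pi / n)) * area n v / mean_ratio powr (n / 2)"
    unfolding phi_def phi0_def m_def[symmetric] P
    using perimeter_pos n tan_pos by (simp add: field_simps)
  have "(pseudo_perimeter n v)\<^sup>2 * (phi n v / phi0 n) =
      mean_ratio\<^sup>2 * ((perimeter n v)\<^sup>2 * (phi n v / phi0 n))"
    by (simp add: pseudo_perimeter_eq power_mult_distrib)
  also have "\<dots> = 4 * (real n * tan (pi / n)) * area n v * (mean_ratio\<^sup>2 / mean_ratio powr (n / 2))"
    unfolding ratio by simp
  also have "mean_ratio\<^sup>2 / mean_ratio powr (n / 2) = mean_ratio powr (2 - n / 2)"
    using mean_ratio by (simp add: powr_diff powr_numeral)
  finally show ?thesis by (simp add: right_diff_distrib)
qed

lemma regular_polygon_deficit: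
  assumes "regular_polygon n v"
  shows "(pseudo_perimeter n v)\<^sup>2 - 4 * (real n * tan (pi / n)) * area n v = 0"
proof -
  have "perimeter n v = real n * (2 * r * sin (pi / n))"
    by (simp add: perimeter_def regular_polygon_formulas(2)[OF assms])
  moreover have "cos (pi / n) \<noteq> 0"
    using n_ge_3 by (intro less_imp_neq[symmetric] cos_gt_zero) (auto simp: field_simps)
  ultimately show ?thesis
    using mean_ratio(3) assms
    by (simp add: pseudo_perimeter_eq regular_polygon_formulas(1) tan_def power2_eq_square)
qed

lemma triangle_phi:
  assumes "n = 3"
  shows "phi n v = phi0 n"
proof -
  let ?L = "perimeter n v"
  define a b d where "a = side_length n v 0" and "b = side_length n v 1" and "d = side_length n v 2"
  have L: "?L = a + b + d"
    by (simp add: perimeter_def assms a_def b_def d_def eval_nat_numeral)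
  have V3: "V (Suc 2) = V 0" by (simp add: vertex_def assms)
  have "{..<3::nat} = {0, 1, 2}" by auto
  then have "range V = {V 0, V 1, V 2}"
    using range_V by (simp add: assms vertex_def)
  then have "area n v = measure lebesgue (convex hull {V 0, V 1, V 2})"
    by (simp add: area_eq_measure_hull)
  also have "\<dots> = sqrt (?L / 2 * (?L / 2 - b) * (?L / 2 - d) * (?L / 2 - a))"
  proof -
    have "dist (V 1) (V 2) = b" "dist (V 0) (V 2) = d" "dist (V 0) (V 1) = a"
      using V3 by (simp_all add: a_def b_def d_def side_length_def dist_commute eval_nat_numeral)
    then show ?thesis unfolding heron_complex L by (simp only: add_ac)
  qed
  also have "?L / 2 * (?L / 2 - b) * (?L / 2 - d) * (?L / 2 - a) =
      (?L\<^sup>2 / 4)\<^sup>2 * (\<Prod>i<n. 1 - 2 * side_length n v i / ?L)"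
  proof -
    have *: "(\<Prod>i<n. 1 - 2 * side_length n v i / ?L) = (1 - 2 * a / ?L) * (1 - 2 * b / ?L) * (1 - 2 * d / ?L)"
      by (simp add: assms a_def b_def d_def eval_nat_numeral)
    show ?thesis unfolding * using perimeter_pos by (simp add: field_simps power2_eq_square)
  qed
  also have "sqrt \<dots> = pseudo_area n v"
    by (simp add: pseudo_area_def real_sqrt_mult)
  finally have "phi n v = 1" using area_pos by (simp add: phi_def)
  moreover have "phi0 3 = 1"
  proof -
    have "(1 / 3 :: real) powr (3 / 2) = (1 / 3) powr (1 + 1 / 2)" by simp
    also have "\<dots> = 1 / 3 * sqrt (1 / 3)" unfolding powr_add by (simp add: powr_half_sqrt)
    finally show ?thesis by (simp add: phi0_def tan_60 real_sqrt_divide)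
  qed
  ultimately show ?thesis using assms by simp
qed

end

theorem corollary2:
  fixes n :: nat and v :: "nat \<Rightarrow> complex"
  assumes "cyclic_polygon n v"
    and "tau n v \<le> 1"
  shows "let D = (pseudo_perimeter n v)\<^sup>2 - 4 * (real n * tan (pi / real n)) * area n v;
             B = (pseudo_perimeter n v)\<^sup>2 * (1 - phi n v / phi0 n)
         in (n \<noteq> 3 \<longrightarrow> D \<ge> B) \<and>
            (n \<noteq> 4 \<longrightarrow> (D = B \<longleftrightarrow> regular_polygon n v)) \<and>
            (n \<noteq> 3 \<longrightarrow> D \<ge> 0) \<and>
            (n \<noteq> 4 \<longrightarrow> (D = 0 \<longleftrightarrow> regular_polygon n v)) \<and>
            (regular_polygon n v \<longrightarrow> phi n v = phi0 n \<and> D = B \<and> D = 0)"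
proof -
  obtain c r where cr: "r > 0" "\<forall>i<n. v i \<in> sphere c r" "polygon n v"
    using assms(1) unfolding cyclic_polygon_def by blast
  then interpret inscribed_polygon n v c r
    by unfold_locales (auto simp: dist_norm norm_minus_commute)
  define D where "D = (pseudo_perimeter n v)\<^sup>2 - 4 * (real n * tan (pi / real n)) * area n v"
  define B where "B = (pseudo_perimeter n v)\<^sup>2 * (1 - phi n v / phi0 n)"
  let ?C = "4 * (real n * tan (pi / real n)) * area n v"
  have C: "?C > 0" using tan_pos area_pos n_ge_3 by simp
  have DB: "D - B = ?C * (mean_ratio powr (2 - n / 2) - 1)"
    unfolding D_def B_def deficit_difference by (simp add: algebra_simps)
  have B_nonneg: "B \<ge> 0"
    using assms(2) by (simp add: B_def tau_def)
  have D_ge_B: "D \<ge> B" if "n \<noteq> 3"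
  proof -
    have "mean_ratio powr 0 \<le> mean_ratio powr (2 - n / 2)"
      using mean_ratio n_ge_3 that by (intro powr_mono') auto
    then have "D - B \<ge> 0" unfolding DB using C mean_ratio by simp
    then show ?thesis by simp
  qed
  have D_eq_B: "D = B \<longleftrightarrow> regular_polygon n v" if "n \<noteq> 4"
  proof -
    have "D = B \<longleftrightarrow> mean_ratio powr (2 - n / 2) = 1"
      using DB C by (metis diff_eq_diff_eq diff_self less_irrefl mult_eq_0_iff right_minus_eq)
    also have "\<dots> \<longleftrightarrow> (2 - n / 2) * ln mean_ratio = 0"
      using mean_ratio(1) by (simp add: powr_def)
    also have "\<dots> \<longleftrightarrow> mean_ratio = 1"
      using that mean_ratio(1) by (auto simp: field_simps)
    finally show ?thesis using mean_ratio(3) by simp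
  qed
  have regular: "phi n v = phi0 n \<and> D = B \<and> D = 0" if "regular_polygon n v"
  proof -
    have "D = 0" using regular_polygon_deficit that by (simp add: D_def)
    moreover have "D = B" using DB mean_ratio(3) that by simp
    moreover have "pseudo_perimeter n v \<noteq> 0"
      using perimeter_pos mean_ratio(1) by (simp add: pseudo_perimeter_eq)
    ultimately have "phi n v / phi0 n = 1" by (simp add: B_def)
    then have "phi n v = phi0 n" by (cases "phi0 n = 0") auto
    with \<open>D = 0\<close> \<open>D = B\<close> show ?thesis by blast
  qed
  have D_eq_0: "D = 0 \<longleftrightarrow> regular_polygon n v" if "n \<noteq> 4"
  proof
    assume "D = 0"
    moreover have "B = 0"
    proof (cases "n = 3")
      case True
      then have "phi n v = phi0 n" by (rule triangle_phi)
      moreover have "phi0 n \<noteq> 0" using n_ge_3 tan_pos mean_pos by (simp add: phi0_def)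
      ultimately show ?thesis by (simp add: B_def)
    next
      case False
      then show ?thesis using D_ge_B B_nonneg \<open>D = 0\<close> by simp
    qed
    ultimately show "regular_polygon n v" using D_eq_B that by simp
  qed (use regular in blast)
  have D_nonneg: "D \<ge> 0" if "n \<noteq> 3"
    using D_ge_B[OF that] B_nonneg by linarith
  show ?thesis
    unfolding Let_def D_def[symmetric] B_def[symmetric]
    using D_ge_B D_eq_B D_nonneg D_eq_0 regular by blast
qed

end
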